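(* There are absolute constants $C,a>0$ such that for all integers $K\ge2$ and $V\ge1$ and all sufficiently large $T$ (depending on $K$ and $V$), there are choices of the learning rate $\eta>0$, threshold $\gamma\in(0,1]$ and confidence parameter $\delta\in(0,1)$ (depending only on $K,V,T$) for which the following holds. If the volumes $V^t\in\{1,\dots,V\}$ and the maximum consumption levels $s_i^t\in\{0,1,2,\dots\}$ are chosen by an adaptive adversary, then with probability at least $1-\frac1T$ the regret $R_T$ of the integer-allocation dark pool algorithm with the variance-corrected gradient estimator $\hat g_t$ (described in the context) satisfies $$R_T\le C\,V^2(TK)^{2/3}\,\bigl(\ln(TKV)\bigr)^a,$$ i.e. $R_T=\widetilde O\left(V^2(TK)^{2/3}\right)$.
   Context: Dark pool problem with integral allocations. There are $K$ venues. In each round $t=1,\dots,T$ the learner observes a volume $V^t\in\{1,\dots,V\}$ and chooses nonnegative integers $u_i^t$ ($i=1,\dots,K$) with $\sum_{i=1}^K u_i^t\le V^t$. Venue $i$ has an integer maximum consumption level $s_i^t\ge0$, and the learner receives (and observes only) $r_i^t=\min(u_i^t,s_i^t)$. An adaptive adversary may choose $V^t$ and $s_i^t$ depending on the algorithm's allocations in rounds $1,\dots,t-1$. Regret: $$R_T=\max_{\mathrm{opt}\in\{1,\dots,K\}^V}\sum_{t=1}^T\sum_{i=1}^K\left[\min\left(\sum_{v=1}^{V^t}\mathbf 1(\mathrm{opt}_v=i),\,s_i^t\right)-\min(u_i^t,s_i^t)\right],$$ i.e. the comparator always allocates the $v$th unit to the fixed venue $\mathrm{opt}_v$. Integer-allocation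 dark pool algorithm with estimator $\hat g_t$. Input: learning rate $\eta>0$, threshold $\gamma\in(0,1]$, confidence parameter $\delta\in(0,1)$, bound $V$ on volumes. Initialize $x_{1,i}^v=1/K$ for $1\le v\le V$, $1\le i\le K$. For $t=1,\dots,T$: 1. Set $v_i^t=\sum_{v=1}^{V^t}x_{t,i}^v$, $f_i^t=\lfloor v_i^t\rfloor$, $d_i^t=v_i^t-f_i^t$, $m=\sum_{i=1}^K d_i^t=V^t-\sum_{i=1}^K f_i^t$ (an integer), and $\bar d_{t,i}=(1-\gamma)d_i^t+\gamma m/K$. 2. Sample (with fresh randomness) a subset of $\{1,\dots,K\}$ of size $m$ from a distribution under which each $i$ belongs to the subset with probability $\bar d_{t,i}$. (Such a distribution is obtained by mixing, with weights $1-\gamma$ and $\gamma$, a distribution on $m$-subsets with inclusion probabilities $d_i^t$ and the uniform distribution on $m$-subsets.) 3. Play $u_i^t=f_i^t+1$ if $i$ is in the sampled subset and $u_i^t=f_i^t$ otherwise; receive $r_i^t=\min(u_i^t,s_i^t)$. 4. Let $\tilde V_{t,i}\le V^t$ be the largest index $v_0$ such that $\sum_{v=1}^{v_0}x_{t,i}^v\le f_i^t$. Let $\chi_i^t=1$ if $i$ is in the sampled subset (i.e. the allocation at venue $i$ was rounded up) and $\chi_i^t=0$ otherwise. Define $$\tilde g_{t,i}^v=\begin{cases}\mathbf 1(s_i^t\ge f_i^t)-\dfrac{\mathbf 1(s_i^t=f_i^t)\,\chi_i^t}{\bar d_{t,i}} & \text{if } v\le\tilde V_{t,i},\\[2mm]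 \dfrac{\mathbf 1(s_i^t\ge v_i^t)\,\chi_i^t}{\bar d_{t,i}} & \text{if }\tilde V_{t,i}+1\le v\le V^t,\end{cases} \qquad \hat g_{t,i}^v=\tilde g_{t,i}^v+\frac{10\gamma}{K\bar d_{t,i}}\sqrt{\ln\frac1\delta}\quad(v\le V^t),$$ and $\hat g_{t,i}^v=0$ for $v>V^t$. Convention: when $m=0$ (so $\bar d_{t,i}=0$) all terms with $\bar d_{t,i}$ in the denominator are taken to be $0$. 5. Update $x_{t+1,i}^v\propto x_{t,i}^v\exp(\eta\hat g_{t,i}^v)$, normalized so that $\sum_{i=1}^K x_{t+1,i}^v=1$ for each $v$. *)

theory Defs
  imports "HOL-Probability.Probability"
begin

text \<open>Venues are indexed by \<open>i \<in> {1..K}\<close> and units by \<open>v \<in> {1..V}\<close>; \<open>n\<close> is the volume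
  of the current round. A weight matrix \<open>x\<close> is applied as \<open>x i v\<close>.\<close>

type_synonym weights = "nat \<Rightarrow> nat \<Rightarrow> real"

definition fvol :: "weights \<Rightarrow> nat \<Rightarrow> nat \<Rightarrow> real" where
  "fvol x n i = (\<Sum>v=1..n. x i v)"

definition base_alloc :: "weights \<Rightarrow> nat \<Rightarrow> nat \<Rightarrow> nat" where
  "base_alloc x n i = nat \<lfloor>fvol x n i\<rfloor>"

definition resid :: "weights \<Rightarrow> nat \<Rightarrow> nat \<Rightarrow> real" where
  "resid x n i = fvol x n i - real (base_alloc x n i)"

definition residual_mass :: "nat \<Rightarrow> weights \<Rightarrow> nat \<Rightarrow> real" where
  "residual_mass K x n = (\<Sum>i=1..K. resid x n i)"

definition dbar :: "nat \<Rightarrow> real \<Rightarrow> weights \<Rightarrow> nat \<Rightarrow> nat \<Rightarrow> real" where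
  "dbar K \<gamma> x n i = (1 - \<gamma>) * resid x n i + \<gamma> * residual_mass K x n / real K"

definition weight_matrix :: "nat \<Rightarrow> nat \<Rightarrow> weights \<Rightarrow> bool" where
  "weight_matrix K V x \<longleftrightarrow>
     (\<forall>v\<in>{1..V}. (\<forall>i\<in>{1..K}. 0 \<le> x i v) \<and> (\<Sum>i=1..K. x i v) = 1)"

definition alloc :: "weights \<Rightarrow> nat \<Rightarrow> nat set \<Rightarrow> nat \<Rightarrow> nat" where
  "alloc x n A i = base_alloc x n i + (if i \<in> A then 1 else 0)"

definition Vtilde :: "weights \<Rightarrow> nat \<Rightarrow> nat \<Rightarrow> nat" where
  "Vtilde x n i = Max {w \<in> {0..n}. (\<Sum>v=1..w. x i v) \<le> real (base_alloc x n i)}"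

text \<open>In the two estimators below, if the residual mass is 0 then \<open>dbar\<close> vanishes and division
  by zero makes the corresponding terms 0, which is the intended convention.\<close>

definition g_tilde ::
  "nat \<Rightarrow> real \<Rightarrow> weights \<Rightarrow> nat \<Rightarrow> (nat \<Rightarrow> nat) \<Rightarrow> nat set \<Rightarrow> nat \<Rightarrow> nat \<Rightarrow> real" where
  "g_tilde K \<gamma> x n s A i v =
     (if v \<le> Vtilde x n i
      then of_bool (base_alloc x n i \<le> s i)
           - of_bool (s i = base_alloc x n i) * of_bool (i \<in> A) / dbar K \<gamma> x n i
      else of_bool (fvol x n i \<le> real (s i)) * of_bool (i \<in> A) / dbar K \<gamma> x n i)"

definition g_hat ::
  "nat \<Rightarrow> real \<Rightarrow> real \<Rightarrow> weights \<Rightarrow> nat \<Rightarrow> (nat \<Rightarrow> nat) \<Rightarrow> nat set \<Rightarrow> nat \<Rightarrow> nat \<Rightarrow> real" where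
  "g_hat K \<gamma> \<delta> x n s A i v =
     (if v \<le> n
      then g_tilde K \<gamma> x n s A i v + 10 * \<gamma> / (real K * dbar K \<gamma> x n i) * sqrt (ln (1 / \<delta>))
      else 0)"

definition mw_update :: "nat \<Rightarrow> real \<Rightarrow> weights \<Rightarrow> (nat \<Rightarrow> nat \<Rightarrow> real) \<Rightarrow> weights" where
  "mw_update K \<eta> x g i v =
     x i v * exp (\<eta> * g i v) / (\<Sum>j=1..K. x j v * exp (\<eta> * g j v))"

text \<open>A history lists \<open>(V\<^sup>t, s\<^sup>t, u\<^sup>t)\<close> for the rounds played so far, in order.\<close>

type_synonym history = "(nat \<times> (nat \<Rightarrow> nat) \<times> (nat \<Rightarrow> nat)) list"

text \<open>The adversary draws \<open>(V\<^sup>t, s\<^sup>t)\<close> given the past; a point mass is a deterministic choice.\<close>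

type_synonym adversary = "history \<Rightarrow> (nat \<times> (nat \<Rightarrow> nat)) pmf"

definition valid_adversary :: "nat \<Rightarrow> adversary \<Rightarrow> bool" where
  "valid_adversary V adv \<longleftrightarrow> (\<forall>h. \<forall>(n, s) \<in> set_pmf (adv h). n \<in> {1..V})"

text \<open>The algorithm only prescribes the size and the inclusion probabilities of the random set of
  venues that are rounded up. A sampler is an arbitrary choice of such a distribution in every
  round; it sees the current weights and volume, and the past.\<close>

type_synonym sampler = "history \<Rightarrow> weights \<Rightarrow> nat \<Rightarrow> nat set pmf"

definition valid_sampler :: "nat \<Rightarrow> nat \<Rightarrow> real \<Rightarrow> sampler \<Rightarrow> bool" where
  "valid_sampler K V \<gamma> samp \<longleftrightarrow>
     (\<forall>h x n. weight_matrix K V x \<longrightarrow> n \<in> {1..V} \<longrightarrow>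
        (\<forall>A \<in> set_pmf (samp h x n). A \<subseteq> {1..K} \<and> real (card A) = residual_mass K x n) \<and>
        (\<forall>i \<in> {1..K}. measure_pmf.prob (samp h x n) {A. i \<in> A} = dbar K \<gamma> x n i))"

text \<open>Joint law, after \<open>t\<close> rounds, of the next weights and the history. The set \<open>A\<close> is drawn
  without access to the current levels \<open>s\<close>.\<close>

primrec dark_pool ::
  "nat \<Rightarrow> real \<Rightarrow> real \<Rightarrow> real \<Rightarrow> sampler \<Rightarrow> adversary \<Rightarrow> nat \<Rightarrow> (weights \<times> history) pmf" where
  "dark_pool K \<eta> \<gamma> \<delta> samp adv 0 = return_pmf (\<lambda>i v. 1 / real K, [])"
| "dark_pool K \<eta> \<gamma> \<delta> samp adv (Suc t) =
     do {
       (x, h) \<leftarrow> dark_pool K \<eta> \<gamma> \<delta> samp adv t;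
       (n, s) \<leftarrow> adv h;
       A \<leftarrow> samp h x n;
       return_pmf (mw_update K \<eta> x (g_hat K \<gamma> \<delta> x n s A), h @ [(n, s, alloc x n A)])
     }"

definition regret :: "nat \<Rightarrow> nat \<Rightarrow> history \<Rightarrow> real" where
  "regret K V h =
     (MAX opt \<in> {1..V} \<rightarrow>\<^sub>E {1..K}.
        \<Sum>(n, s, u) \<leftarrow> h. \<Sum>i=1..K.
          real (min (\<Sum>v=1..n. of_bool (opt v = i)) (s i)) - real (min (u i) (s i)))"

end

(* Since min(., s) is concave, the regret is at most the sum over the units v of the linear
   regrets of the weight vectors x^v, plus the error of the randomised rounding. For a unit v and a
   venue j, let S be the accumulated linear regret against j. The uncorrected estimator is unbiased
   with second moment at most K/gamma, so exp(eta S) / x_j^v grows in expectation at most by a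
   factor exp(O(eta^2 K/gamma)) per round: dividing by x_j^v makes the exponential weights
   telescope. This gives exponential tails for S, with no concentration of the random quadratic
   terms to be controlled; the rounding error is treated by the same exponential moment. A union
   bound over the pairs (v, j) with gamma = (K/T)^(1/3), eta = K^(-1/3) T^(-2/3) gives the bound. The
   variance correction is not needed for it, and delta is taken so close to 1 that the correction
   is negligible. *)

theory Submission
  imports Defs
begin

section \<open>Exponential moments from first and second moments\<close>

text \<open>For negative \<open>x\<close> the claim amounts to
  \<open>1 <= (1 + x + x^2) * exp (-x)\<close>. There the quadratic Taylor polynomial of
  \<open>exp (-x)\<close> is a lower bound, and multiplying it by the first factor exceeds 1 by
  exactly \<open>x^2 * (1 - x + x^2) / 2\<close>.\<close>

lemma exp_le_quadratic:
  fixes x :: real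
  assumes "x \<le> 1"
  shows "exp x \<le> 1 + x + x\<^sup>2"
proof (cases "x \<ge> 0")
  case True
  then show ?thesis using exp_bound assms by auto
next
  case False
  have "1 \<le> (1 + x + x\<^sup>2) * (1 - x + x\<^sup>2 / 2)"
  proof -
    have "(1 + x + x\<^sup>2) * (1 - x + x\<^sup>2 / 2) - 1 = x\<^sup>2 * ((1 - x + x\<^sup>2) / 2)"
      by (simp add: algebra_simps power2_eq_square) (simp add: field_simps)
    moreover have "0 \<le> x\<^sup>2 * ((1 - x + x\<^sup>2) / 2)"
      using False by simp
    ultimately show ?thesis by linarith
  qed
  moreover have pos: "0 < 1 - x + x\<^sup>2 / 2"
    using False by (simp add: add_pos_nonneg)
  moreover have "1 - x + x\<^sup>2 / 2 \<le> exp (- x)"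
    using exp_lower_Taylor_quadratic[of "-x"] False by simp
  moreover have pos': "0 \<le> 1 + x + x\<^sup>2"
  proof -
    have "1 + x + x\<^sup>2 = (x + 1/2)\<^sup>2 + 3/4" by (simp add: power2_eq_square field_simps)
    then show ?thesis by simp
  qed
  ultimately have "1 \<le> (1 + x + x\<^sup>2) * exp (- x)"
    by (meson mult_left_mono order_trans)
  then show ?thesis by (simp add: exp_minus field_simps)
qed

lemma expectation_exp_le:
  fixes X :: "'a \<Rightarrow> real"
  assumes fin: "finite (set_pmf p)"
    and le1: "\<And>a. a \<in> set_pmf p \<Longrightarrow> X a \<le> 1"
    and mean: "measure_pmf.expectation p X \<le> \<mu>"
    and second: "measure_pmf.expectation p (\<lambda>a. (X a)\<^sup>2) \<le> \<sigma>"
  shows "measure_pmf.expectation p (\<lambda>a. exp (X a)) \<le> exp (\<mu> + \<sigma>)"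
proof -
  note [simp] = integrable_measure_pmf_finite[OF fin]
  have "measure_pmf.expectation p (\<lambda>a. exp (X a))
      \<le> measure_pmf.expectation p (\<lambda>a. 1 + X a + (X a)\<^sup>2)"
    by (intro integral_mono_AE) (auto simp: AE_measure_pmf_iff intro!: exp_le_quadratic le1)
  also have "\<dots> = 1 + measure_pmf.expectation p X + measure_pmf.expectation p (\<lambda>a. (X a)\<^sup>2)"
    by simp
  also have "\<dots> \<le> 1 + (\<mu> + \<sigma>)" using mean second by simp
  also have "\<dots> \<le> exp (\<mu> + \<sigma>)" by (rule exp_ge_add_one_self)
  finally show ?thesis .
qed

section \<open>Positive weights and linearisation of the regret\<close>

text \<open>Strict positivity is tracked because the potential of a unit divides by a
  weight.\<close>

definition pos_weights :: "nat \<Rightarrow> nat \<Rightarrow> weights \<Rightarrow> bool" where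
  "pos_weights K V x \<longleftrightarrow>
     (\<forall>v\<in>{1..V}. (\<forall>i\<in>{1..K}. 0 < x i v) \<and> (\<Sum>i=1..K. x i v) = 1)"

lemma pos_weights_weight_matrix: "pos_weights K V x \<Longrightarrow> weight_matrix K V x"
  unfolding pos_weights_def weight_matrix_def by (auto intro: less_imp_le)

lemma pos_weights_mw_update:
  assumes "pos_weights K V x" "K \<ge> 1"
  shows "pos_weights K V (mw_update K \<eta> x g)"
  unfolding pos_weights_def
proof (intro ballI conjI)
  fix v assume v: "v \<in> {1..V}"
  have pos: "0 < x i v * exp (\<eta> * g i v)" if "i \<in> {1..K}" for i
    using assms v that unfolding pos_weights_def by simp
  then have Z: "0 < (\<Sum>j=1..K. x j v * exp (\<eta> * g j v))"
    using assms(2) by (intro sum_pos) auto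
  show "0 < mw_update K \<eta> x g i v" if "i \<in> {1..K}" for i
    unfolding mw_update_def using pos[OF that] Z by simp
  show "(\<Sum>i=1..K. mw_update K \<eta> x g i v) = 1"
    unfolding mw_update_def using Z by (simp flip: sum_divide_distrib)
qed

text \<open>With \<open>f\<close> the floor of the fractional allocation \<open>v\<close>, this is a supergradient of
  \<open>min (\<cdot>) s\<close> at \<open>v\<close>; at an integral \<open>v\<close> it is the left derivative if no venue has a
  residual and the right derivative otherwise, since these are the values that the estimator
  is unbiased for.\<close>

definition grad :: "nat \<Rightarrow> weights \<Rightarrow> nat \<Rightarrow> (nat \<Rightarrow> nat) \<Rightarrow> nat \<Rightarrow> real" where
  "grad K x n s i =
     (if residual_mass K x n = 0 then of_bool (base_alloc x n i \<le> s i)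
      else of_bool (base_alloc x n i < s i))"

text \<open>Instantaneous regret against venue \<open>j\<close> in the expert problem of unit
  \<open>v\<close> with rewards \<open>grad\<close>; units beyond the current volume are
  idle.\<close>

definition unit_gap :: "nat \<Rightarrow> weights \<Rightarrow> nat \<Rightarrow> (nat \<Rightarrow> nat) \<Rightarrow> nat \<Rightarrow> nat \<Rightarrow> real" where
  "unit_gap K x n s v j =
     (if v \<le> n then grad K x n s j - (\<Sum>i=1..K. x i v * grad K x n s i) else 0)"

text \<open>The levels are integers, so between \<open>base_alloc\<close> and
  \<open>base_alloc + 1\<close> the reward is affine with slope
  \<open>of_bool (base_alloc x n i < s i)\<close>. Passing from the fractional to the rounded
  allocation therefore loses exactly this sum.\<close>

definition rounding_gap :: "nat \<Rightarrow> weights \<Rightarrow> nat \<Rightarrow> (nat \<Rightarrow> nat) \<Rightarrow> nat set \<Rightarrow> real" where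
  "rounding_gap K x n s A =
     (\<Sum>i=1..K. (resid x n i - of_bool (i \<in> A)) * of_bool (base_alloc x n i < s i))"

definition round_regret ::
  "nat \<Rightarrow> (nat \<Rightarrow> nat) \<Rightarrow> nat \<times> (nat \<Rightarrow> nat) \<times> (nat \<Rightarrow> nat) \<Rightarrow> real" where
  "round_regret K opt = (\<lambda>(n, s, u). \<Sum>i=1..K.
     real (min (\<Sum>v=1..n. of_bool (opt v = i)) (s i)) - real (min (u i) (s i)))"

context
  fixes K V n :: nat and x :: weights
  assumes wm: "weight_matrix K V x" and n: "n \<in> {1..V}"
begin

lemma fvol_nonneg: "i \<in> {1..K} \<Longrightarrow> 0 \<le> fvol x n i"
  unfolding fvol_def using wm n unfolding weight_matrix_def by (intro sum_nonneg) auto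

lemma real_base_alloc: "i \<in> {1..K} \<Longrightarrow> real (base_alloc x n i) = of_int \<lfloor>fvol x n i\<rfloor>"
  unfolding base_alloc_def using fvol_nonneg[of i] by simp

lemma resid_nonneg: "i \<in> {1..K} \<Longrightarrow> 0 \<le> resid x n i"
  and resid_less_1: "i \<in> {1..K} \<Longrightarrow> resid x n i < 1"
  unfolding resid_def using real_base_alloc[of i] by linarith+

lemma sum_fvol: "(\<Sum>i=1..K. fvol x n i) = real n"
proof -
  have "(\<Sum>i=1..K. fvol x n i) = (\<Sum>v=1..n. \<Sum>i=1..K. x i v)"
    unfolding fvol_def by (rule sum.swap)
  also have "\<dots> = (\<Sum>v=1..n. 1)"
    using wm n unfolding weight_matrix_def by (intro sum.cong) auto
  finally show ?thesis by simp
qed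

lemma residual_mass_le: "residual_mass K x n \<le> real n"
  unfolding residual_mass_def resid_def sum_subtractf sum_fvol
  by (simp add: sum_nonneg)

lemma residual_mass_nonneg: "0 \<le> residual_mass K x n"
  unfolding residual_mass_def using resid_nonneg by (intro sum_nonneg) auto

lemma residual_mass_0_iff:
  "residual_mass K x n = 0 \<longleftrightarrow> (\<forall>i\<in>{1..K}. resid x n i = 0)"
  unfolding residual_mass_def using resid_nonneg by (intro sum_nonneg_eq_0_iff) auto

text \<open>Insert the reward at the fractional allocation \<open>fvol\<close>: going from there to
  \<open>y\<close> is the supergradient inequality of a concave function, going to the rounded
  allocation is exactly linear. Zero residual mass makes every \<open>fvol\<close> integral, where
  the left derivative is also a supergradient.\<close>

lemma venue_regret_le:
  assumes "i \<in> {1..K}"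
  shows "real (min y (s i)) - real (min (alloc x n A i) (s i))
    \<le> grad K x n s i * (real y - fvol x n i)
      + (resid x n i - of_bool (i \<in> A)) * of_bool (base_alloc x n i < s i)"
proof -
  have f: "fvol x n i = real (base_alloc x n i) + resid x n i"
    unfolding resid_def by simp
  have r: "0 \<le> resid x n i" "resid x n i < 1"
    using resid_nonneg resid_less_1 assms by auto
  show ?thesis
  proof (cases "residual_mass K x n = 0")
    case True
    then have "resid x n i = 0" using residual_mass_0_iff assms by auto
    then show ?thesis using f True
      by (auto simp: grad_def alloc_def min_def of_bool_def not_le)
  next
    case False
    then show ?thesis using f r
      by (auto simp: grad_def alloc_def min_def of_bool_def not_le)
  qed
qed

text \<open>Both the comparator's allocation and \<open>fvol\<close> are sums over units, so
  exchanging the sums turns the linear bound over venues into one expert problem per unit.\<close>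

lemma round_regret_le:
  assumes opt: "opt \<in> {1..V} \<rightarrow> {1..K}"
  shows "round_regret K opt (n, s, alloc x n A)
    \<le> (\<Sum>v=1..V. unit_gap K x n s v (opt v)) + rounding_gap K x n s A"
proof -
  let ?g = "grad K x n s"
  have "round_regret K opt (n, s, alloc x n A)
      \<le> (\<Sum>i=1..K. ?g i * (real (\<Sum>v=1..n. of_bool (opt v = i)) - fvol x n i)
          + (resid x n i - of_bool (i \<in> A)) * of_bool (base_alloc x n i < s i))"
    unfolding round_regret_def prod.case by (intro sum_mono venue_regret_le)
  also have "\<dots> = (\<Sum>i=1..K. \<Sum>v=1..n. ?g i * of_bool (opt v = i) - x i v * ?g i)
      + rounding_gap K x n s A"
    unfolding sum.distrib rounding_gap_def fvol_def
    by (simp add: sum_subtractf sum_distrib_left right_diff_distrib mult.commute)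
  also have "(\<Sum>i=1..K. \<Sum>v=1..n. ?g i * of_bool (opt v = i) - x i v * ?g i)
      = (\<Sum>v=1..n. \<Sum>i=1..K. ?g i * of_bool (opt v = i) - x i v * ?g i)"
    by (rule sum.swap)
  also have "\<dots> = (\<Sum>v=1..n. unit_gap K x n s v (opt v))"
  proof (intro sum.cong refl)
    fix v assume v: "v \<in> {1..n}"
    then have "opt v \<in> {1..K}" using opt n by auto
    then have "(\<Sum>i=1..K. ?g i * of_bool (opt v = i)) = ?g (opt v)"
      by (simp add: of_bool_def if_distrib[of "\<lambda>y. _ * y"] cong: if_cong)
    then show "(\<Sum>i=1..K. ?g i * of_bool (opt v = i) - x i v * ?g i) = unit_gap K x n s v (opt v)"
      using v unfolding unit_gap_def by (simp add: sum_subtractf)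
  qed
  also have "\<dots> = (\<Sum>v=1..V. unit_gap K x n s v (opt v))"
    using n by (intro sum.mono_neutral_left) (auto simp: unit_gap_def)
  finally show ?thesis .
qed

end

section \<open>The gradient estimator in one round\<close>

text \<open>With an integral allocation the full prefix \<open>n\<close> is admissible in the
  maximum. Hence the second branch of the estimator occurs only at a fractional allocation.\<close>

lemma Vtilde_less_imp_resid:
  assumes "Vtilde x n i < n"
  shows "resid x n i \<noteq> 0"
proof
  assume "resid x n i = 0"
  then have "n \<in> {w \<in> {0..n}. (\<Sum>v=1..w. x i v) \<le> real (base_alloc x n i)}"
    unfolding resid_def fvol_def by simp
  then have "n \<le> Vtilde x n i" unfolding Vtilde_def by (intro Max_ge) auto
  then show False using assms by simp
qed

text \<open>Weights, volume and the law \<open>p\<close> of the rounded-up set are fixed, but the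
  levels \<open>s\<close> are not: the lemmas hold for every \<open>s\<close>, which is how an
  adversary that does not see the current draw is handled.\<close>

locale sampled_round =
  fixes K V n :: nat and \<gamma> :: real and x :: weights and p :: "nat set pmf"
  assumes K: "K \<ge> 1" and gamma: "0 < \<gamma>" "\<gamma> \<le> 1"
    and pw: "pos_weights K V x" and n: "n \<in> {1..V}"
    and p_sub: "\<And>A. A \<in> set_pmf p \<Longrightarrow> A \<subseteq> {1..K}"
    and p_card: "\<And>A. A \<in> set_pmf p \<Longrightarrow> real (card A) = residual_mass K x n"
    and p_prob: "\<And>i. i \<in> {1..K} \<Longrightarrow> measure_pmf.prob p {A. i \<in> A} = dbar K \<gamma> x n i"
begin

lemmas wm = pos_weights_weight_matrix[OF pw]

lemma finite_p: "finite (set_pmf p)"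
  using p_sub finite_subset[of "set_pmf p" "Pow {1..K}"] by auto

lemma integrable_p [simp]: "integrable (measure_pmf p) (f :: nat set \<Rightarrow> real)"
  by (rule integrable_measure_pmf_finite[OF finite_p])

lemma expectation_mem:
  assumes "i \<in> {1..K}"
  shows "measure_pmf.expectation p (\<lambda>A. of_bool (i \<in> A)) = dbar K \<gamma> x n i"
proof -
  have "(\<lambda>A. of_bool (i \<in> A) :: real) = indicator {A. i \<in> A}"
    by (auto simp: indicator_def)
  then show ?thesis using p_prob[OF assms] by simp
qed

text \<open>The residual mass is the size of a set, hence an integer. This is what gives
  \<open>dbar\<close> the lower bound \<open>\<gamma> / K\<close> whenever it is nonzero.\<close>

lemma residual_mass_ge_1:
  assumes "residual_mass K x n \<noteq> 0"
  shows "1 \<le> residual_mass K x n"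
proof -
  obtain A where "A \<in> set_pmf p" using set_pmf_not_empty[of p] by blast
  then have "real (card A) = residual_mass K x n" by (rule p_card)
  then show ?thesis using assms by (metis of_nat_0_eq_iff One_nat_def Suc_leI neq0_conv of_nat_1 of_nat_le_iff)
qed

lemma dbar_ge:
  assumes "residual_mass K x n \<noteq> 0" "i \<in> {1..K}"
  shows "\<gamma> / real K \<le> dbar K \<gamma> x n i"
proof -
  have "\<gamma> * 1 / real K \<le> \<gamma> * residual_mass K x n / real K"
    using residual_mass_ge_1[OF assms(1)] gamma by (intro divide_right_mono mult_left_mono) auto
  moreover have "0 \<le> (1 - \<gamma>) * resid x n i"
    using resid_nonneg[OF wm n assms(2)] gamma by simp
  ultimately show ?thesis unfolding dbar_def by simp
qed

lemma dbar_eq_0: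
  assumes "residual_mass K x n = 0" "i \<in> {1..K}"
  shows "dbar K \<gamma> x n i = 0"
  using assms residual_mass_0_iff[OF wm n] unfolding dbar_def by simp

text \<open>When the residual mass vanishes, \<open>1 / 0 = 0\<close> satisfies the same bounds, so
  users of this lemma need no case split.\<close>

lemma inverse_dbar_le:
  assumes "i \<in> {1..K}"
  shows "0 \<le> 1 / dbar K \<gamma> x n i" "1 / dbar K \<gamma> x n i \<le> real K / \<gamma>"
proof -
  have "0 \<le> 1 / dbar K \<gamma> x n i \<and> 1 / dbar K \<gamma> x n i \<le> real K / \<gamma>"
  proof (cases "residual_mass K x n = 0")
    case True
    then show ?thesis using dbar_eq_0[OF True assms] gamma by simp
  next
    case False
    have "0 < \<gamma> / real K" using gamma K by simp
    then show ?thesis using dbar_ge[OF False assms] le_imp_inverse_le[of "\<gamma> / real K" "dbar K \<gamma> x n i"]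
      by (simp add: inverse_eq_divide)
  qed
  then show "0 \<le> 1 / dbar K \<gamma> x n i" "1 / dbar K \<gamma> x n i \<le> real K / \<gamma>" by auto
qed

lemma one_le_K_gamma: "1 \<le> real K / \<gamma>"
proof -
  have "\<gamma> \<le> real K" using K gamma by linarith
  then show ?thesis using gamma by simp
qed

lemma g_tilde_bound:
  assumes "i \<in> {1..K}"
  shows "\<bar>g_tilde K \<gamma> x n s A i v\<bar> \<le> real K / \<gamma>"
proof -
  have "\<bar>1 - 1 / dbar K \<gamma> x n i\<bar> \<le> real K / \<gamma>"
    using inverse_dbar_le[OF assms] one_le_K_gamma by linarith
  then show ?thesis
    using inverse_dbar_le[OF assms] one_le_K_gamma
    unfolding g_tilde_def by (auto simp: of_bool_def)
qed

text \<open>Inclusion has probability \<open>dbar\<close>, so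
  \<open>of_bool (i \<in> A) / dbar\<close> has mean 1 and second moment \<open>1 / dbar\<close>, at
  most \<open>K / \<gamma>\<close>. With zero residual mass only the deterministic first branch
  survives.\<close>

lemma g_tilde_moments:
  assumes i: "i \<in> {1..K}" and v: "v \<le> n"
  shows "measure_pmf.expectation p (\<lambda>A. g_tilde K \<gamma> x n s A i v) = grad K x n s i"
    and "measure_pmf.expectation p (\<lambda>A. (g_tilde K \<gamma> x n s A i v)\<^sup>2) \<le> real K / \<gamma>"
proof -
  let ?d = "dbar K \<gamma> x n i"
  let ?E = "measure_pmf.expectation p"
  have "?E (\<lambda>A. g_tilde K \<gamma> x n s A i v) = grad K x n s i
    \<and> ?E (\<lambda>A. (g_tilde K \<gamma> x n s A i v)\<^sup>2) \<le> real K / \<gamma>"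
  proof (cases "residual_mass K x n = 0")
    case True
    then have "resid x n i = 0" using residual_mass_0_iff[OF wm n] i by simp
    then have "\<not> Vtilde x n i < n" using Vtilde_less_imp_resid by auto
    then have "g_tilde K \<gamma> x n s A i v = grad K x n s i" for A
      using v True dbar_eq_0[OF True i] unfolding g_tilde_def grad_def by simp
    then show ?thesis using one_le_K_gamma gamma True by (auto simp: grad_def of_bool_def)
  next
    case False
    have d: "?d > 0" using dbar_ge[OF False i] gamma K
      by (smt (verit, best) divide_pos_pos of_nat_0_less_iff less_le_trans zero_less_one)
    have d1: "1 / ?d \<le> real K / \<gamma>" using inverse_dbar_le[OF i] by simp
    have sq: "(of_bool b :: real)\<^sup>2 = of_bool b" for b by simp
    consider (hi) "v > Vtilde x n i" | (eq) "v \<le> Vtilde x n i" "s i = base_alloc x n i"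
      | (ne) "v \<le> Vtilde x n i" "s i \<noteq> base_alloc x n i" by linarith
    then show ?thesis
    proof cases
      case hi
      \<comment> \<open>In this branch \<open>fvol\<close> lies strictly between consecutive
        integers, so comparing it with the integer \<open>s i\<close> is the same as asking for
        \<open>base_alloc < s i\<close>.\<close>
      have r: "resid x n i > 0" using Vtilde_less_imp_resid[of x n i] hi v resid_nonneg[OF wm n i] by fastforce
      have c: "fvol x n i \<le> real (s i) \<longleftrightarrow> base_alloc x n i < s i"
        using r resid_less_1[OF wm n i] unfolding resid_def by linarith
      have g: "g_tilde K \<gamma> x n s A i v = of_bool (base_alloc x n i < s i) / ?d * of_bool (i \<in> A)" for A
        using hi unfolding g_tilde_def c by simp
      show ?thesis unfolding g power_mult_distrib sq integral_mult_right_zero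
          expectation_mem[OF i] using d d1 False gamma
        by (auto simp: grad_def power2_eq_square of_bool_def)
    next
      case eq
      \<comment> \<open>Here \<open>s i\<close> equals the base allocation: the subtracted term has
        mean 1 and lowers the estimate from the left derivative 1 to the right derivative 0.\<close>
      have g: "g_tilde K \<gamma> x n s A i v = 1 - 1 / ?d * of_bool (i \<in> A)" for A
        using eq unfolding g_tilde_def by simp
      have g2: "(1 - 1 / ?d * of_bool (i \<in> A))\<^sup>2 = 1 + (1 / ?d\<^sup>2 - 2 / ?d) * of_bool (i \<in> A)" for A
        by (auto simp: power2_eq_square algebra_simps of_bool_def)
      have m: "?E (\<lambda>A. 1 - 1 / ?d * of_bool (i \<in> A)) = 1 - 1 / ?d * ?d"
        by (simp add: expectation_mem[OF i] del: times_divide_eq_left)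
      have m2: "?E (\<lambda>A. 1 + (1 / ?d\<^sup>2 - 2 / ?d) * of_bool (i \<in> A)) = 1 + (1 / ?d\<^sup>2 - 2 / ?d) * ?d"
        by (simp add: expectation_mem[OF i])
      have "1 + (1 / ?d\<^sup>2 - 2 / ?d) * ?d = 1 / ?d - 1"
        using d by (simp add: field_simps power2_eq_square)
      then show ?thesis unfolding g g2 m m2 using d d1 False eq by (simp add: grad_def)
    next
      case ne
      have g: "g_tilde K \<gamma> x n s A i v = of_bool (base_alloc x n i < s i)" for A
        using ne unfolding g_tilde_def by auto
      show ?thesis unfolding g using ne False one_le_K_gamma gamma by (auto simp: grad_def)
    qed
  qed
  then show "?E (\<lambda>A. g_tilde K \<gamma> x n s A i v) = grad K x n s i"
    "?E (\<lambda>A. (g_tilde K \<gamma> x n s A i v)\<^sup>2) \<le> real K / \<gamma>" by auto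
qed

text \<open>The ratio of \<open>\<gamma> / K\<close> to \<open>dbar\<close> is at most 1, so the
  correction, with \<open>\<beta>\<close> for the square root, can distort a difference of estimates
  by at most \<open>10 * \<beta>\<close>.\<close>

lemma bonus_bounds:
  assumes "i \<in> {1..K}" "0 \<le> \<beta>"
  shows "0 \<le> 10 * \<gamma> / (real K * dbar K \<gamma> x n i) * \<beta>"
    and "10 * \<gamma> / (real K * dbar K \<gamma> x n i) * \<beta> \<le> 10 * \<beta>"
proof -
  have e: "10 * \<gamma> / (real K * dbar K \<gamma> x n i) * \<beta> = (10 * \<beta> * \<gamma> / real K) * (1 / dbar K \<gamma> x n i)"
    by simp
  show "0 \<le> 10 * \<gamma> / (real K * dbar K \<gamma> x n i) * \<beta>"
    unfolding e using inverse_dbar_le[OF assms(1)] gamma assms by (intro mult_nonneg_nonneg) auto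
  have "(10 * \<beta> * \<gamma> / real K) * (1 / dbar K \<gamma> x n i) \<le> (10 * \<beta> * \<gamma> / real K) * (real K / \<gamma>)"
    using inverse_dbar_le[OF assms(1)] gamma assms by (intro mult_left_mono) auto
  also have "\<dots> = 10 * \<beta>" using K gamma by simp
  finally show "10 * \<gamma> / (real K * dbar K \<gamma> x n i) * \<beta> \<le> 10 * \<beta>" unfolding e .
qed

section \<open>One-round growth of the unit potential\<close>

text \<open>The second factor is left linear in \<open>grad\<close> instead of being bounded by an
  exponential, because it is averaged over \<open>i\<close> with the weights afterwards and the
  average must produce the mean gradient.\<close>

lemma expectation_exp_g_hat_diff:
  assumes i: "i \<in> {1..K}" and j: "j \<in> {1..K}" and v: "v \<le> n"
    and eta: "0 < \<eta>" "2 * \<eta> * real K / \<gamma> \<le> 1" and delta: "0 < \<delta>" "\<delta> < 1"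
  shows "measure_pmf.expectation p (\<lambda>A. exp (\<eta> * (g_hat K \<gamma> \<delta> x n s A i v - g_hat K \<gamma> \<delta> x n s A j v)))
    \<le> exp (10 * \<eta> * sqrt (ln (1 / \<delta>)))
      * (1 + \<eta> * (grad K x n s i - grad K x n s j) + 4 * \<eta>\<^sup>2 * real K / \<gamma>)"
proof -
  let ?E = "measure_pmf.expectation p"
  define X where "X = (\<lambda>A. g_tilde K \<gamma> x n s A i v)"
  define Y where "Y = (\<lambda>A. g_tilde K \<gamma> x n s A j v)"
  define \<beta> where "\<beta> = sqrt (ln (1 / \<delta>))"
  have beta: "0 \<le> \<beta>" unfolding \<beta>_def using delta by simp
  have le1: "\<eta> * (X A - Y A) \<le> 1" for A
  proof -
    have "X A - Y A \<le> 2 * (real K / \<gamma>)"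
      using g_tilde_bound[OF i, of s A v] g_tilde_bound[OF j, of s A v]
      unfolding X_def Y_def by linarith
    then have "\<eta> * (X A - Y A) \<le> \<eta> * (2 * (real K / \<gamma>))"
      using eta by (intro mult_left_mono) auto
    then show ?thesis using eta(2) by (simp add: algebra_simps)
  qed
  \<comment> \<open>Only the marginals of the sampler are prescribed, so the mixed moment of the two
    estimates is unknown; this inequality avoids it.\<close>
  have sq: "(a - b)\<^sup>2 \<le> 2 * a\<^sup>2 + 2 * b\<^sup>2" for a b :: real
    using zero_le_power2[of "a + b"] by (simp add: power2_eq_square algebra_simps)
  have "?E (\<lambda>A. exp (\<eta> * (g_hat K \<gamma> \<delta> x n s A i v - g_hat K \<gamma> \<delta> x n s A j v)))
      \<le> ?E (\<lambda>A. exp (10 * \<eta> * \<beta>) * (1 + \<eta> * (X A - Y A) + \<eta>\<^sup>2 * (2 * (X A)\<^sup>2 + 2 * (Y A)\<^sup>2)))"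
  proof (intro integral_mono)
    fix A
    have "g_hat K \<gamma> \<delta> x n s A i v - g_hat K \<gamma> \<delta> x n s A j v \<le> 10 * \<beta> + (X A - Y A)"
      using bonus_bounds[OF i beta] bonus_bounds[OF j beta] v
      unfolding g_hat_def X_def Y_def \<beta>_def by auto
    then have "exp (\<eta> * (g_hat K \<gamma> \<delta> x n s A i v - g_hat K \<gamma> \<delta> x n s A j v))
        \<le> exp (\<eta> * (10 * \<beta> + (X A - Y A)))"
      using eta by simp
    also have "\<dots> = exp (10 * \<eta> * \<beta>) * exp (\<eta> * (X A - Y A))"
      by (simp add: algebra_simps flip: exp_add)
    also have "exp (\<eta> * (X A - Y A)) \<le> 1 + \<eta> * (X A - Y A) + (\<eta> * (X A - Y A))\<^sup>2"
      using le1 by (rule exp_le_quadratic)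
    also have "(\<eta> * (X A - Y A))\<^sup>2 \<le> \<eta>\<^sup>2 * (2 * (X A)\<^sup>2 + 2 * (Y A)\<^sup>2)"
      unfolding power_mult_distrib by (intro mult_left_mono sq) simp
    finally show "exp (\<eta> * (g_hat K \<gamma> \<delta> x n s A i v - g_hat K \<gamma> \<delta> x n s A j v))
      \<le> exp (10 * \<eta> * \<beta>) * (1 + \<eta> * (X A - Y A) + \<eta>\<^sup>2 * (2 * (X A)\<^sup>2 + 2 * (Y A)\<^sup>2))"
      by simp
  qed simp_all
  also have "\<dots> = exp (10 * \<eta> * \<beta>)
      * (1 + \<eta> * (?E X - ?E Y) + \<eta>\<^sup>2 * (2 * ?E (\<lambda>A. (X A)\<^sup>2) + 2 * ?E (\<lambda>A. (Y A)\<^sup>2)))"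
    by simp
  also have "\<dots> \<le> exp (10 * \<eta> * \<beta>)
      * (1 + \<eta> * (grad K x n s i - grad K x n s j) + \<eta>\<^sup>2 * (2 * (real K / \<gamma>) + 2 * (real K / \<gamma>)))"
    using g_tilde_moments[OF i v] g_tilde_moments[OF j v] eta(1) unfolding X_def Y_def
    by (intro mult_left_mono add_mono) auto
  also have "\<eta>\<^sup>2 * (2 * (real K / \<gamma>) + 2 * (real K / \<gamma>)) = 4 * \<eta>\<^sup>2 * real K / \<gamma>"
    by simp
  finally show ?thesis unfolding \<beta>_def .
qed

text \<open>The factor \<open>1 / x j v\<close> telescopes along the multiplicative updates, which turns the
  usual regret bound of the exponential weights into a supermartingale.\<close>

lemma expectation_unit_potential:
  assumes v: "v \<in> {1..V}" and j: "j \<in> {1..K}"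
    and eta: "0 < \<eta>" "2 * \<eta> * real K / \<gamma> \<le> 1" and delta: "0 < \<delta>" "\<delta> < 1"
  shows "measure_pmf.expectation p (\<lambda>A. exp (\<eta> * (S + unit_gap K x n s v j))
      / mw_update K \<eta> x (g_hat K \<gamma> \<delta> x n s A) j v)
    \<le> exp (10 * \<eta> * sqrt (ln (1 / \<delta>)) + 4 * \<eta>\<^sup>2 * real K / \<gamma>) * (exp (\<eta> * S) / x j v)"
    (is "_ \<le> exp (?b + ?q) * _")
proof -
  let ?E = "measure_pmf.expectation p"
  have xpos: "0 < x i v" if "i \<in> {1..K}" for i
    using pw v that unfolding pos_weights_def by auto
  have xsum: "(\<Sum>i=1..K. x i v) = 1"
    using pw v unfolding pos_weights_def by auto
  have b: "0 \<le> ?b" using eta delta by simp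
  have q: "0 \<le> ?q" using gamma by simp
  show ?thesis
  proof (cases "v \<le> n")
    case False
    \<comment> \<open>For an idle unit all estimates are 0 and the normaliser is 1, so the potential
      stays put; nonnegative rates cover this case.\<close>
    have "mw_update K \<eta> x (g_hat K \<gamma> \<delta> x n s A) j v = x j v" for A
      using False xsum unfolding mw_update_def g_hat_def by simp
    moreover have "1 * (exp (\<eta> * S) / x j v) \<le> exp (?b + ?q) * (exp (\<eta> * S) / x j v)"
      using b q xpos[OF j] by (intro mult_right_mono) auto
    ultimately show ?thesis using False unfolding unit_gap_def by simp
  next
    case True
    let ?g = "grad K x n s"
    let ?h = "\<lambda>A i. g_hat K \<gamma> \<delta> x n s A i v"
    define \<mu> where "\<mu> = (\<Sum>i=1..K. x i v * ?g i)"
    \<comment> \<open>The reciprocal of the updated weight is the normaliser divided by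
      \<open>x j v * exp (\<eta> * ?h A j)\<close>; pulling the exponential into the sum leaves only
      differences of estimates.\<close>
    have inv: "exp (\<eta> * (S + unit_gap K x n s v j)) / mw_update K \<eta> x (g_hat K \<gamma> \<delta> x n s A) j v
        = (exp (\<eta> * S) / x j v * exp (\<eta> * (?g j - \<mu>)))
          * (\<Sum>i=1..K. x i v * exp (\<eta> * (?h A i - ?h A j)))" for A
    proof -
      have "(\<Sum>i=1..K. x i v * exp (\<eta> * (?h A i - ?h A j)))
          = (\<Sum>i=1..K. x i v * exp (\<eta> * ?h A i)) / exp (\<eta> * ?h A j)"
        unfolding sum_divide_distrib by (simp add: right_diff_distrib exp_diff)
      then show ?thesis
        using True unfolding mw_update_def unit_gap_def \<mu>_def
        by (simp add: distrib_left exp_add)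
    qed
    have "?E (\<lambda>A. \<Sum>i=1..K. x i v * exp (\<eta> * (?h A i - ?h A j)))
        = (\<Sum>i=1..K. x i v * ?E (\<lambda>A. exp (\<eta> * (?h A i - ?h A j))))"
      by simp
    also have "\<dots> \<le> (\<Sum>i=1..K. x i v * (exp ?b * (1 + \<eta> * (?g i - ?g j) + ?q)))"
      using expectation_exp_g_hat_diff[OF _ j True eta delta]
      by (intro sum_mono mult_left_mono) (auto intro!: less_imp_le[OF xpos])
    also have "\<dots> = (\<Sum>i=1..K. exp ?b * (1 - \<eta> * ?g j + ?q) * x i v + exp ?b * \<eta> * (x i v * ?g i))"
      by (intro sum.cong) (simp_all add: algebra_simps)
    also have "\<dots> = exp ?b * (1 - \<eta> * ?g j + ?q) * (\<Sum>i=1..K. x i v) + exp ?b * \<eta> * \<mu>"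
      unfolding sum.distrib \<mu>_def by (simp flip: sum_distrib_left)
    also have "\<dots> = exp ?b * (1 + (\<eta> * (\<mu> - ?g j) + ?q))"
      unfolding xsum by (simp add: algebra_simps)
    also have "\<dots> \<le> exp ?b * exp (\<eta> * (\<mu> - ?g j) + ?q)"
      by (intro mult_left_mono exp_ge_add_one_self) simp
    finally have E: "?E (\<lambda>A. \<Sum>i=1..K. x i v * exp (\<eta> * (?h A i - ?h A j)))
      \<le> exp ?b * exp (\<eta> * (\<mu> - ?g j) + ?q)" .
    have "?E (\<lambda>A. exp (\<eta> * (S + unit_gap K x n s v j)) / mw_update K \<eta> x (g_hat K \<gamma> \<delta> x n s A) j v)
        \<le> (exp (\<eta> * S) / x j v * exp (\<eta> * (?g j - \<mu>))) * (exp ?b * exp (\<eta> * (\<mu> - ?g j) + ?q))"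
      unfolding inv integral_mult_right_zero using xpos[OF j] by (intro mult_left_mono E) auto
    also have "\<dots> = exp (\<eta> * S) / x j v
        * (exp (\<eta> * (?g j - \<mu>)) * (exp ?b * exp (\<eta> * (\<mu> - ?g j) + ?q)))"
      by (simp only: mult.assoc)
    \<comment> \<open>The true regret \<open>?g j - \<mu>\<close> of the round cancels against the
      drift of the averaged estimates, leaving only bias and variance costs.\<close>
    also have "exp (\<eta> * (?g j - \<mu>)) * (exp ?b * exp (\<eta> * (\<mu> - ?g j) + ?q)) = exp (?b + ?q)"
      unfolding exp_add[symmetric] by (rule arg_cong[of _ _ exp]) (simp add: algebra_simps)
    finally show ?thesis by (simp only: mult.commute)
  qed
qed

section \<open>The rounding error in one round\<close>

text \<open>Rounding preserves the total: the residuals and the indicators of \<open>A\<close> both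
  sum to the residual mass, so the gap is a difference of two numbers between 0 and that
  mass.\<close>

lemma rounding_gap_bound:
  assumes "A \<in> set_pmf p"
  shows "\<bar>rounding_gap K x n s A\<bar> \<le> real V"
proof -
  let ?c = "\<lambda>i. of_bool (base_alloc x n i < s i) :: real"
  let ?m = "residual_mass K x n"
  have split: "rounding_gap K x n s A
      = (\<Sum>i=1..K. resid x n i * ?c i) - (\<Sum>i=1..K. of_bool (i \<in> A) * ?c i)"
    unfolding rounding_gap_def by (simp add: left_diff_distrib sum_subtractf)
  have "(\<Sum>i=1..K. resid x n i * ?c i) \<le> ?m"
    unfolding residual_mass_def using resid_nonneg[OF wm n]
    by (intro sum_mono) (auto simp: of_bool_def)
  moreover have "0 \<le> (\<Sum>i=1..K. resid x n i * ?c i)"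
    using resid_nonneg[OF wm n] by (intro sum_nonneg) auto
  moreover have "(\<Sum>i=1..K. of_bool (i \<in> A) * ?c i) \<le> (\<Sum>i=1..K. of_bool (i \<in> A))"
    by (intro sum_mono) auto
  moreover have "(\<Sum>i=1..K. of_bool (i \<in> A) :: real) = ?m"
  proof -
    have "(\<Sum>i=1..K. of_bool (i \<in> A) :: real) = real (card ({1..K} \<inter> {i. i \<in> A}))"
      by simp
    also have "{1..K} \<inter> {i. i \<in> A} = A" using p_sub[OF assms] by auto
    finally show ?thesis using p_card[OF assms] by simp
  qed
  moreover have "0 \<le> (\<Sum>i=1..K. of_bool (i \<in> A) * ?c i)"
    by (intro sum_nonneg) auto
  moreover have "?m \<le> real V" using residual_mass_le[OF wm n] n by simp
  ultimately show ?thesis unfolding split by linarith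
qed

text \<open>With inclusion probabilities \<open>resid\<close> the mean would be 0. Uniform
  exploration lowers an inclusion probability by at most \<open>\<gamma> * resid\<close>, and these
  losses sum to at most \<open>\<gamma> * V\<close>.\<close>

lemma expectation_rounding_gap:
  "measure_pmf.expectation p (rounding_gap K x n s) \<le> \<gamma> * real V"
proof -
  let ?c = "\<lambda>i. of_bool (base_alloc x n i < s i) :: real"
  let ?m = "residual_mass K x n"
  have "measure_pmf.expectation p (rounding_gap K x n s)
      = (\<Sum>i=1..K. (resid x n i - dbar K \<gamma> x n i) * ?c i)"
    unfolding rounding_gap_def by (simp add: expectation_mem)
  also have "\<dots> \<le> (\<Sum>i=1..K. \<gamma> * resid x n i)"
  proof (intro sum_mono)
    fix i assume i: "i \<in> {1..K}"
    have "resid x n i - dbar K \<gamma> x n i = \<gamma> * resid x n i - \<gamma> * ?m / real K"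
      unfolding dbar_def by (simp add: algebra_simps)
    moreover have "0 \<le> \<gamma> * ?m / real K" using residual_mass_nonneg[OF wm n] gamma by simp
    moreover have "0 \<le> \<gamma> * resid x n i" using resid_nonneg[OF wm n i] gamma by simp
    ultimately show "(resid x n i - dbar K \<gamma> x n i) * ?c i \<le> \<gamma> * resid x n i"
      by (auto simp: of_bool_def)
  qed
  also have "\<dots> = \<gamma> * ?m" unfolding residual_mass_def by (simp add: sum_distrib_left)
  also have "\<dots> \<le> \<gamma> * real V"
    using residual_mass_le[OF wm n] n gamma by (intro mult_left_mono) auto
  finally show ?thesis .
qed

lemma expectation_rounding_potential:
  assumes eta: "0 < \<eta>" "\<eta> * real V \<le> 1"
  shows "measure_pmf.expectation p (\<lambda>A. exp (\<eta> * (Y + rounding_gap K x n s A)))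
    \<le> exp (\<eta> * \<gamma> * real V + \<eta>\<^sup>2 * (real V)\<^sup>2) * exp (\<eta> * Y)"
proof -
  have "measure_pmf.expectation p (\<lambda>A. exp (\<eta> * rounding_gap K x n s A))
      \<le> exp (\<eta> * \<gamma> * real V + \<eta>\<^sup>2 * (real V)\<^sup>2)"
  proof (rule expectation_exp_le[OF finite_p])
    fix A assume A: "A \<in> set_pmf p"
    have "\<eta> * rounding_gap K x n s A \<le> \<eta> * real V"
      using rounding_gap_bound[OF A, of s] eta by (intro mult_left_mono) auto
    then show "\<eta> * rounding_gap K x n s A \<le> 1" using eta by linarith
  next
    show "measure_pmf.expectation p (\<lambda>A. \<eta> * rounding_gap K x n s A) \<le> \<eta> * \<gamma> * real V"
      using expectation_rounding_gap[of s] eta by (simp add: mult.assoc)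
    have "measure_pmf.expectation p (\<lambda>A. (\<eta> * rounding_gap K x n s A)\<^sup>2)
        \<le> measure_pmf.expectation p (\<lambda>A. \<eta>\<^sup>2 * (real V)\<^sup>2)"
      unfolding power_mult_distrib
      using rounding_gap_bound[of _ s]
      by (intro integral_mono_AE)
        (auto simp: AE_measure_pmf_iff intro!: mult_left_mono abs_le_square_iff[THEN iffD1])
    then show "measure_pmf.expectation p (\<lambda>A. (\<eta> * rounding_gap K x n s A)\<^sup>2) \<le> \<eta>\<^sup>2 * (real V)\<^sup>2"
      by simp
  qed
  then show ?thesis
    by (simp add: distrib_left exp_add mult.commute)
qed

end

section \<open>Tail bounds for the whole game\<close>

text \<open>Stated for nonnegative integrals, since the adversary's law may have infinite support
  and integrability of the potentials is then not immediate.\<close>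

lemma pmf_Markov:
  fixes f :: "'a \<Rightarrow> real"
  assumes "(\<integral>\<^sup>+\<omega>. ennreal (f \<omega>) \<partial>measure_pmf p) \<le> ennreal b" "0 < a" "0 \<le> b"
  shows "measure_pmf.prob p {\<omega>. a \<le> f \<omega>} \<le> b / a"
proof -
  have "{\<omega>. a \<le> f \<omega>} \<subseteq> {\<omega> \<in> UNIV. 1 \<le> ennreal (1 / a) * ennreal (f \<omega>)}"
    using assms(2) by (auto simp: ennreal_mult'[symmetric] field_simps)
  then have "emeasure p {\<omega>. a \<le> f \<omega>} \<le> emeasure p {\<omega> \<in> UNIV. 1 \<le> ennreal (1 / a) * ennreal (f \<omega>)}"
    by (intro emeasure_mono) auto
  also have "\<dots> \<le> ennreal (1 / a) * (\<integral>\<^sup>+\<omega>. ennreal (f \<omega>) * indicator UNIV \<omega> \<partial>p)"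
    by (rule nn_integral_Markov_inequality) auto
  also have "\<dots> \<le> ennreal (1 / a) * ennreal b"
    using assms(1) by (intro mult_left_mono) auto
  also have "\<dots> = ennreal (b / a)"
    using assms by (simp add: ennreal_mult'[symmetric])
  finally show ?thesis
    using assms by (simp add: measure_pmf.emeasure_eq_measure)
qed

lemma regret_le_iff:
  assumes "K \<ge> 1"
  shows "regret K V h \<le> b \<longleftrightarrow> (\<forall>opt \<in> {1..V} \<rightarrow>\<^sub>E {1..K}. (\<Sum>r\<leftarrow>h. round_regret K opt r) \<le> b)"
proof -
  have fin: "finite ({1..V} \<rightarrow>\<^sub>E {1..K})" by (intro finite_PiE) auto
  have ne: "{1..V} \<rightarrow>\<^sub>E {1..K} \<noteq> {}" using assms by (simp add: PiE_eq_empty_iff)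
  show ?thesis unfolding regret_def round_regret_def
    using fin ne by (subst Max_le_iff) auto
qed

text \<open>The two upper bounds on \<open>\<eta>\<close> keep the exponents for estimate
  differences and for the rounding gap below 1, as \<open>exp_le_quadratic\<close> requires.\<close>

locale dark_pool_game =
  fixes K V :: nat and \<eta> \<gamma> \<delta> :: real and samp :: sampler and adv :: adversary
  assumes K: "K \<ge> 1" and gamma: "0 < \<gamma>" "\<gamma> \<le> 1" and delta: "0 < \<delta>" "\<delta> < 1"
    and eta: "0 < \<eta>" "2 * \<eta> * real K / \<gamma> \<le> 1" "\<eta> * real V \<le> 1"
    and samp: "valid_sampler K V \<gamma> samp" and adv: "valid_adversary V adv"
begin

lemma sampled_round:
  assumes "pos_weights K V x" "n \<in> {1..V}"
  shows "sampled_round K V n \<gamma> x (samp h x n)"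
  using samp assms K gamma pos_weights_weight_matrix[OF assms(1)]
  unfolding valid_sampler_def by unfold_locales auto

definition next_state ::
  "weights \<times> history \<times> weights \<times> real \<Rightarrow> nat \<Rightarrow> (nat \<Rightarrow> nat) \<Rightarrow> nat set
    \<Rightarrow> weights \<times> history \<times> weights \<times> real" where
  "next_state = (\<lambda>(x, h, S, Y) n s A.
     (mw_update K \<eta> x (g_hat K \<gamma> \<delta> x n s A), h @ [(n, s, alloc x n A)],
      \<lambda>j v. S j v + unit_gap K x n s v j, Y + rounding_gap K x n s A))"

text \<open>\<open>S j v\<close> is the accumulated linear regret of unit \<open>v\<close> against venue \<open>j\<close>, and \<open>Y\<close> the
  accumulated loss from rounding.\<close>

primrec tracked :: "nat \<Rightarrow> (weights \<times> history \<times> weights \<times> real) pmf" where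
  "tracked 0 = return_pmf (\<lambda>i v. 1 / real K, [], \<lambda>j v. 0, 0)"
| "tracked (Suc t) =
     do {
       st \<leftarrow> tracked t;
       (n, s) \<leftarrow> adv (fst (snd st));
       A \<leftarrow> samp (fst (snd st)) (fst st) n;
       return_pmf (next_state st n s A)
     }"

text \<open>\<open>S\<close> and \<open>Y\<close> are ghost components: they never influence the
  weights or the history, so forgetting them recovers the original law.\<close>

lemma dark_pool_eq_map_tracked:
  "dark_pool K \<eta> \<gamma> \<delta> samp adv t = map_pmf (\<lambda>(x, h, S, Y). (x, h)) (tracked t)"
proof (induction t)
  case 0
  then show ?case by simp
next
  case (Suc t)
  then show ?case
    by (simp add: map_bind_pmf bind_map_pmf next_state_def case_prod_unfold)
qed

text \<open>The regret bound is pathwise and simultaneous in all comparators. Later it is enough to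
  control the \<open>V * K\<close> quantities \<open>S j v\<close> and \<open>Y\<close>, rather than
  each of the \<open>K^V\<close> comparators.\<close>

lemma tracked_invariant:
  assumes "st \<in> set_pmf (tracked t)"
  shows "case st of (x, h, S, Y) \<Rightarrow> pos_weights K V x \<and>
    (\<forall>opt \<in> {1..V} \<rightarrow> {1..K}. (\<Sum>r\<leftarrow>h. round_regret K opt r) \<le> (\<Sum>v=1..V. S (opt v) v) + Y)"
  using assms
proof (induction t arbitrary: st)
  case 0
  then show ?case using K by (auto simp: pos_weights_def)
next
  case (Suc t)
  then obtain x h S Y n s A where st0: "(x, h, S, Y) \<in> set_pmf (tracked t)"
    and ns: "(n, s) \<in> set_pmf (adv h)" and A: "A \<in> set_pmf (samp h x n)"
    and st: "st = next_state (x, h, S, Y) n s A"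
    by fastforce
  note IH = Suc.IH[OF st0, simplified]
  have n: "n \<in> {1..V}" using adv ns unfolding valid_adversary_def by fastforce
  show ?case
    unfolding st next_state_def prod.case
  proof (intro conjI ballI)
    show "pos_weights K V (mw_update K \<eta> x (g_hat K \<gamma> \<delta> x n s A))"
      using IH K by (intro pos_weights_mw_update) auto
    fix opt assume opt: "opt \<in> {1..V} \<rightarrow> {1..K}"
    have "(\<Sum>r\<leftarrow>h. round_regret K opt r) \<le> (\<Sum>v=1..V. S (opt v) v) + Y" using IH opt by simp
    then show "(\<Sum>r\<leftarrow>h @ [(n, s, alloc x n A)]. round_regret K opt r)
        \<le> (\<Sum>v=1..V. S (opt v) v + unit_gap K x n s v (opt v)) + (Y + rounding_gap K x n s A)"
      using round_regret_le[OF pos_weights_weight_matrix n opt, of x s A] IH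
      by (simp add: sum.distrib)
  qed
qed

text \<open>Supermartingale argument: \<open>n\<close> and \<open>s\<close> are fixed before the
  innermost average over \<open>A\<close>, so a one-round bound uniform in them survives any
  adaptive or randomised adversary.\<close>

lemma nn_integral_tracked_le:
  fixes F :: "weights \<times> history \<times> weights \<times> real \<Rightarrow> ennreal"
  assumes step: "\<And>x h S Y n s. pos_weights K V x \<Longrightarrow> n \<in> {1..V} \<Longrightarrow>
    (\<integral>\<^sup>+A. F (next_state (x, h, S, Y) n s A) \<partial>samp h x n) \<le> c * F (x, h, S, Y)"
  shows "(\<integral>\<^sup>+st. F st \<partial>tracked t) \<le> c ^ t * F (\<lambda>i v. 1 / real K, [], \<lambda>j v. 0, 0)"
proof (induction t)
  case 0
  then show ?case by simp
next
  case (Suc t)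
  have "(\<integral>\<^sup>+st. F st \<partial>tracked (Suc t)) = (\<integral>\<^sup>+st. \<integral>\<^sup>+ns. \<integral>\<^sup>+A. F (next_state st (fst ns) (snd ns) A)
      \<partial>samp (fst (snd st)) (fst st) (fst ns) \<partial>adv (fst (snd st)) \<partial>tracked t)"
    by (simp add: case_prod_beta)
  also have "\<dots> \<le> (\<integral>\<^sup>+st. \<integral>\<^sup>+ns. c * F st \<partial>adv (fst (snd st)) \<partial>tracked t)"
  proof (intro nn_integral_mono_AE)
    show "AE st in tracked t. (\<integral>\<^sup>+ns. \<integral>\<^sup>+A. F (next_state st (fst ns) (snd ns) A)
        \<partial>samp (fst (snd st)) (fst st) (fst ns) \<partial>adv (fst (snd st)))
      \<le> (\<integral>\<^sup>+ns. c * F st \<partial>adv (fst (snd st)))"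
      unfolding AE_measure_pmf_iff
    proof (intro ballI nn_integral_mono_AE, unfold AE_measure_pmf_iff, intro ballI)
      fix st ns assume st: "st \<in> set_pmf (tracked t)" and ns: "ns \<in> set_pmf (adv (fst (snd st)))"
      have "fst ns \<in> {1..V}" using adv ns unfolding valid_adversary_def by (auto simp: case_prod_beta)
      then show "(\<integral>\<^sup>+A. F (next_state st (fst ns) (snd ns) A)
          \<partial>samp (fst (snd st)) (fst st) (fst ns)) \<le> c * F st"
        using tracked_invariant[OF st] step[of "fst st" "fst ns" "fst (snd st)" "fst (snd (snd st))" "snd (snd (snd st))" "snd ns"]
        by (simp add: case_prod_beta)
    qed
  qed
  also have "\<dots> = c * (\<integral>\<^sup>+st. F st \<partial>tracked t)"
    by (simp add: nn_integral_cmult measure_pmf.emeasure_space_1)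
  also have "\<dots> \<le> c * (c ^ t * F (\<lambda>i v. 1 / real K, [], \<lambda>j v. 0, 0))"
    using Suc.IH by (intro mult_left_mono) auto
  finally show ?case by (simp add: mult.assoc)
qed

definition unit_rate :: real where
  "unit_rate = 10 * \<eta> * sqrt (ln (1 / \<delta>)) + 4 * \<eta>\<^sup>2 * real K / \<gamma>"

definition rounding_rate :: real where
  "rounding_rate = \<eta> * \<gamma> * real V + \<eta>\<^sup>2 * (real V)\<^sup>2"

text \<open>Weights are at most 1, so dividing by \<open>x j v\<close> only increases the integrand.
  The factor \<open>K\<close> is the initial value of the potential, where every weight is
  \<open>1 / K\<close>.\<close>

lemma nn_integral_exp_unit:
  assumes v: "v \<in> {1..V}" and j: "j \<in> {1..K}"
  shows "(\<integral>\<^sup>+st. (case st of (x, h, S, Y) \<Rightarrow> exp (\<eta> * S j v)) \<partial>tracked t)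
    \<le> ennreal (exp (real t * unit_rate) * real K)"
proof -
  define F where "F = (\<lambda>st :: weights \<times> history \<times> weights \<times> real.
    case st of (x, h, S, Y) \<Rightarrow> ennreal (exp (\<eta> * S j v) / x j v))"
  have "(\<integral>\<^sup>+st. (case st of (x, h, S, Y) \<Rightarrow> exp (\<eta> * S j v)) \<partial>tracked t) \<le> (\<integral>\<^sup>+st. F st \<partial>tracked t)"
  proof (intro nn_integral_mono_AE, unfold AE_measure_pmf_iff, intro ballI)
    fix st assume st: "st \<in> set_pmf (tracked t)"
    obtain x h S Y where st_eq: "st = (x, h, S, Y)" by (cases st) auto
    have pw: "pos_weights K V x" using tracked_invariant[OF st] st_eq by simp
    have "x j v \<le> (\<Sum>i=1..K. x i v)"
      using pw v j unfolding pos_weights_def by (intro member_le_sum) (auto intro: less_imp_le)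
    then have "x j v \<le> 1" "0 < x j v" using pw v j unfolding pos_weights_def by auto
    then show "ennreal (case st of (x, h, S, Y) \<Rightarrow> exp (\<eta> * S j v)) \<le> F st"
      unfolding st_eq F_def by (auto simp: field_simps intro!: ennreal_leI)
  qed
  also have "\<dots> \<le> ennreal (exp unit_rate) ^ t * F (\<lambda>i v. 1 / real K, [], \<lambda>j v. 0, 0)"
  proof (rule nn_integral_tracked_le)
    fix x :: weights and h :: history and S Y n s
    assume pw: "pos_weights K V x" and n: "n \<in> {1..V}"
    interpret sampled_round K V n \<gamma> x "samp h x n" using sampled_round[OF pw n] .
    have pos: "0 < mw_update K \<eta> x (g_hat K \<gamma> \<delta> x n s A) j v" for A
      using pos_weights_mw_update[OF pw K] v j unfolding pos_weights_def by auto
    have "(\<integral>\<^sup>+A. F (next_state (x, h, S, Y) n s A) \<partial>samp h x n)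
        = (\<integral>\<^sup>+A. ennreal (exp (\<eta> * (S j v + unit_gap K x n s v j))
            / mw_update K \<eta> x (g_hat K \<gamma> \<delta> x n s A) j v) \<partial>samp h x n)"
      unfolding F_def next_state_def by simp
    \<comment> \<open>Within one round only finitely many sets \<open>A\<close> can occur, so the
      integral is an ordinary expectation and the one-round estimate applies.\<close>
    also have "\<dots> = ennreal (measure_pmf.expectation (samp h x n)
        (\<lambda>A. exp (\<eta> * (S j v + unit_gap K x n s v j)) / mw_update K \<eta> x (g_hat K \<gamma> \<delta> x n s A) j v))"
      by (intro nn_integral_eq_integral integrable_p AE_I2 divide_nonneg_pos pos exp_ge_zero)
    also have "\<dots> \<le> ennreal (exp unit_rate * (exp (\<eta> * S j v) / x j v))"
      unfolding unit_rate_def using eta delta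
      by (intro ennreal_leI expectation_unit_potential[OF v j]) auto
    finally show "(\<integral>\<^sup>+A. F (next_state (x, h, S, Y) n s A) \<partial>samp h x n)
        \<le> ennreal (exp unit_rate) * F (x, h, S, Y)"
      unfolding F_def by (simp add: ennreal_mult'[symmetric])
  qed
  also have "\<dots> = ennreal (exp (real t * unit_rate) * real K)"
    unfolding F_def by (simp add: ennreal_power ennreal_mult' exp_of_nat_mult)
  finally show ?thesis .
qed

lemma nn_integral_exp_rounding:
  "(\<integral>\<^sup>+st. (case st of (x, h, S, Y) \<Rightarrow> exp (\<eta> * Y)) \<partial>tracked t) \<le> ennreal (exp (real t * rounding_rate))"
proof -
  define F where "F = (\<lambda>st :: weights \<times> history \<times> weights \<times> real.
    ennreal (case st of (x, h, S, Y) \<Rightarrow> exp (\<eta> * Y)))"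
  have "(\<integral>\<^sup>+st. F st \<partial>tracked t) \<le> ennreal (exp rounding_rate) ^ t * F (\<lambda>i v. 1 / real K, [], \<lambda>j v. 0, 0)"
  proof (rule nn_integral_tracked_le)
    fix x :: weights and h :: history and S Y n s
    assume pw: "pos_weights K V x" and n: "n \<in> {1..V}"
    interpret sampled_round K V n \<gamma> x "samp h x n" using sampled_round[OF pw n] .
    have "(\<integral>\<^sup>+A. F (next_state (x, h, S, Y) n s A) \<partial>samp h x n)
        = (\<integral>\<^sup>+A. ennreal (exp (\<eta> * (Y + rounding_gap K x n s A))) \<partial>samp h x n)"
      unfolding F_def next_state_def by simp
    also have "\<dots> = ennreal (measure_pmf.expectation (samp h x n) (\<lambda>A. exp (\<eta> * (Y + rounding_gap K x n s A))))"
      by (intro nn_integral_eq_integral integrable_p AE_I2 exp_ge_zero)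
    also have "\<dots> \<le> ennreal (exp rounding_rate * exp (\<eta> * Y))"
      unfolding rounding_rate_def using eta by (intro ennreal_leI expectation_rounding_potential) auto
    finally show "(\<integral>\<^sup>+A. F (next_state (x, h, S, Y) n s A) \<partial>samp h x n)
        \<le> ennreal (exp rounding_rate) * F (x, h, S, Y)"
      unfolding F_def by (simp add: ennreal_mult')
  qed
  also have "\<dots> = ennreal (exp (real t * rounding_rate))"
    unfolding F_def by (simp add: ennreal_power exp_of_nat_mult)
  finally show ?thesis unfolding F_def .
qed

lemma prob_unit_ge:
  assumes "v \<in> {1..V}" "j \<in> {1..K}"
  shows "measure_pmf.prob (tracked t)
      {(x, h, S, Y). (ln (real K) + real t * unit_rate + L) / \<eta> \<le> S j v} \<le> exp (- L)"
proof -
  let ?a = "exp (ln (real K) + real t * unit_rate + L)"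
  have "{(x, h, S, Y). (ln (real K) + real t * unit_rate + L) / \<eta> \<le> S j v}
      = {st. ?a \<le> (case st of (x :: weights, h :: history, S, Y :: real) \<Rightarrow> exp (\<eta> * S j v))}"
    using eta by (auto simp: field_simps)
  moreover have "measure_pmf.prob (tracked t) \<dots> \<le> exp (real t * unit_rate) * real K / ?a"
    using nn_integral_exp_unit[OF assms] by (intro pmf_Markov) auto
  moreover have "exp (real t * unit_rate) * real K / ?a = exp (- L)"
    using K by (simp add: exp_add exp_minus field_simps)
  ultimately show ?thesis by simp
qed

lemma prob_rounding_ge:
  "measure_pmf.prob (tracked t) {(x, h, S, Y). (real t * rounding_rate + L) / \<eta> \<le> Y} \<le> exp (- L)"
proof -
  let ?a = "exp (real t * rounding_rate + L)"
  have "{(x, h, S, Y). (real t * rounding_rate + L) / \<eta> \<le> Y}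
      = {st. ?a \<le> (case st of (x :: weights, h :: history, S :: weights, Y) \<Rightarrow> exp (\<eta> * Y))}"
    using eta by (auto simp: field_simps)
  moreover have "measure_pmf.prob (tracked t) \<dots> \<le> exp (real t * rounding_rate) / ?a"
    using nn_integral_exp_rounding by (intro pmf_Markov) auto
  moreover have "exp (real t * rounding_rate) / ?a = exp (- L)"
    by (simp add: exp_add exp_minus field_simps)
  ultimately show ?thesis by simp
qed

text \<open>A union bound over the \<open>V * K\<close> unit tails and the rounding tail; off the
  bad event \<open>tracked_invariant\<close> adds at most one threshold per unit and one for
  rounding.\<close>

theorem regret_high_probability:
  "measure_pmf.prob (dark_pool K \<eta> \<gamma> \<delta> samp adv t)
     {(x, h). regret K V h \<le> real V * ((ln (real K) + real t * unit_rate + L) / \<eta>)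
        + (real t * rounding_rate + L) / \<eta>} \<ge> 1 - (real V * real K + 1) * exp (- L)"
proof -
  define a where "a = (ln (real K) + real t * unit_rate + L) / \<eta>"
  define b where "b = (real t * rounding_rate + L) / \<eta>"
  define U where "U = (\<lambda>(v, j). {(x :: weights, h :: history, S :: weights, Y :: real). a \<le> S j v})"
  define R where "R = {(x :: weights, h :: history, S :: weights, Y). b \<le> Y}"
  let ?I = "{1..V} \<times> {1..K}"
  define bad where "bad = (\<Union>vj\<in>?I. U vj) \<union> R"
  let ?P = "measure_pmf.prob (tracked t)"
  have "?P bad \<le> ?P (\<Union>vj\<in>?I. U vj) + ?P R"
    unfolding bad_def by (intro measure_Un_le) auto
  also have "?P (\<Union>vj\<in>?I. U vj) \<le> (\<Sum>vj\<in>?I. ?P (U vj))"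
    by (intro measure_pmf.finite_measure_subadditive_finite) auto
  also have "\<dots> \<le> (\<Sum>vj\<in>?I. exp (- L))"
    using prob_unit_ge unfolding U_def a_def by (intro sum_mono) auto
  also have "?P R \<le> exp (- L)"
    using prob_rounding_ge unfolding R_def b_def .
  finally have "?P bad \<le> (real V * real K + 1) * exp (- L)"
    by (simp add: algebra_simps)
  moreover have "1 - ?P bad = ?P (UNIV - bad)"
    using measure_pmf.prob_compl[of bad "tracked t"] by simp
  moreover have "?P (UNIV - bad) \<le> ?P {(x, h, S, Y). regret K V h \<le> real V * a + b}"
  proof (intro measure_pmf.finite_measure_mono_AE, unfold AE_measure_pmf_iff, intro ballI impI)
    fix st assume st: "st \<in> set_pmf (tracked t)" and nb: "st \<in> UNIV - bad"
    obtain x h S Y where st_eq: "st = (x, h, S, Y)" by (cases st) auto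
    have S: "S j v \<le> a" if "v \<in> {1..V}" "j \<in> {1..K}" for v j
      using nb that unfolding st_eq bad_def U_def by fastforce
    have Y: "Y \<le> b" using nb unfolding st_eq bad_def R_def by fastforce
    have "(\<Sum>r\<leftarrow>h. round_regret K opt r) \<le> real V * a + b" if "opt \<in> {1..V} \<rightarrow>\<^sub>E {1..K}" for opt
    proof -
      have opt: "opt \<in> {1..V} \<rightarrow> {1..K}" using that by auto
      have "(\<Sum>r\<leftarrow>h. round_regret K opt r) \<le> (\<Sum>v=1..V. S (opt v) v) + Y"
        using tracked_invariant[OF st] opt unfolding st_eq by simp
      also have "(\<Sum>v=1..V. S (opt v) v) \<le> (\<Sum>v=1..V. a)"
        using opt by (intro sum_mono S) auto
      finally show ?thesis using Y by simp
    qed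
    then show "st \<in> {(x, h, S, Y). regret K V h \<le> real V * a + b}"
      using regret_le_iff[OF K] unfolding st_eq by simp
  qed simp
  moreover have "?P {(x, h, S, Y). regret K V h \<le> real V * a + b}
      = measure_pmf.prob (dark_pool K \<eta> \<gamma> \<delta> samp adv t) {(x, h). regret K V h \<le> real V * a + b}"
    unfolding dark_pool_eq_map_tracked
    by (simp add: vimage_def case_prod_unfold)
  ultimately show ?thesis unfolding a_def b_def by linarith
qed

end

section \<open>Choice of parameters and the final rate\<close>

text \<open>To be read with \<open>k\<close>, \<open>a\<close> the cube roots of \<open>K\<close>,
  \<open>T\<close>, with \<open>v\<close> for \<open>V\<close> and \<open>l\<close> for the
  logarithm. Each summand is a multiple of \<open>B * l\<close>, and the multiples add up as 3 + 10
  + 4 + 1 + 1 + 2 = 21.\<close>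

lemma regret_bound_arith:
  fixes k a v l c L :: real
  assumes "1 \<le> k" "1 \<le> a" "1 \<le> v" "1 \<le> l" "c \<le> l" "L \<le> 2 * l"
  shows "v * ((c + L) * (k * a\<^sup>2) + 10 + 4 * (k * a\<^sup>2)) + k * a\<^sup>2 * v + a * v\<^sup>2 / k + L * (k * a\<^sup>2)
    \<le> 21 * (v\<^sup>2 * (a\<^sup>2 * k\<^sup>2) * l)"
proof -
  define w where "w = v * (k * a\<^sup>2)"
  define B where "B = v\<^sup>2 * (a\<^sup>2 * k\<^sup>2)"
  have a2: "1 \<le> a\<^sup>2" "a \<le> a\<^sup>2" using assms by (auto intro: self_le_power)
  have ka: "1 \<le> k * a\<^sup>2" using mult_mono[of 1 k 1 "a\<^sup>2"] assms a2 by simp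
  have vk: "1 \<le> v * k" using mult_mono[of 1 v 1 k] assms by simp
  have kw: "k * a\<^sup>2 \<le> w" unfolding w_def using mult_right_mono[of 1 v "k * a\<^sup>2"] assms ka by simp
  have vw: "v \<le> w" unfolding w_def using mult_left_mono[of 1 "k * a\<^sup>2" v] assms ka by simp
  have wB: "w \<le> B"
  proof -
    have "B = (v * k) * w" unfolding B_def w_def by (simp add: power2_eq_square)
    then show ?thesis using mult_right_mono[of 1 "v * k" w] vk kw ka by simp
  qed
  have last: "a * v\<^sup>2 / k \<le> B"
  proof -
    have "a * v\<^sup>2 / k \<le> a * v\<^sup>2" using assms by (simp add: divide_le_eq mult_left_mono[of 1 k "a * v\<^sup>2", simplified])
    also have "\<dots> \<le> a\<^sup>2 * v\<^sup>2" using a2 by (intro mult_right_mono) auto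
    also have "\<dots> * 1 \<le> (a\<^sup>2 * v\<^sup>2) * k\<^sup>2" using assms by (intro mult_left_mono) auto
    finally show ?thesis unfolding B_def by (simp add: mult_ac)
  qed
  have w0: "0 \<le> w" using kw ka by linarith
  have B0: "0 \<le> B" using wB w0 by linarith
  have wl: "w * l \<le> B * l" using wB assms by (intro mult_right_mono) auto
  have Bl: "B \<le> B * l" using mult_left_mono[of 1 l B] assms B0 by simp
  have "v * ((c + L) * (k * a\<^sup>2) + 10 + 4 * (k * a\<^sup>2)) = (c + L) * w + 10 * v + 4 * w"
    unfolding w_def by (simp add: algebra_simps)
  moreover have "(c + L) * w \<le> (3 * l) * w" using assms w0 by (intro mult_right_mono) auto
  moreover have "L * (k * a\<^sup>2) \<le> (2 * l) * w"
  proof -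
    have "L * (k * a\<^sup>2) \<le> (2 * l) * (k * a\<^sup>2)" using assms ka by (intro mult_right_mono) auto
    also have "\<dots> \<le> (2 * l) * w" using assms kw by (intro mult_left_mono) auto
    finally show ?thesis .
  qed
  moreover have "k * a\<^sup>2 * v = w" unfolding w_def by simp
  moreover have "(3 * l) * w = 3 * (w * l)" "(2 * l) * w = 2 * (w * l)" by simp_all
  ultimately have "v * ((c + L) * (k * a\<^sup>2) + 10 + 4 * (k * a\<^sup>2)) + k * a\<^sup>2 * v + a * v\<^sup>2 / k + L * (k * a\<^sup>2)
      \<le> 21 * (B * l)"
    using last wl Bl wB vw w0 by linarith
  then show ?thesis unfolding B_def by simp
qed

theorem corollary1:
  "\<exists>C a :: real. C > 0 \<and> a > 0 \<and>
     (\<forall>K V :: nat. K \<ge> 2 \<longrightarrow> V \<ge> 1 \<longrightarrow>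
       (\<exists>T0. \<forall>T \<ge> T0. \<exists>\<eta> \<gamma> \<delta> :: real.
          \<eta> > 0 \<and> 0 < \<gamma> \<and> \<gamma> \<le> 1 \<and> 0 < \<delta> \<and> \<delta> < 1 \<and>
          (\<forall>samp adv. valid_sampler K V \<gamma> samp \<longrightarrow> valid_adversary V adv \<longrightarrow>
             measure_pmf.prob (dark_pool K \<eta> \<gamma> \<delta> samp adv T)
               {(x, h). regret K V h \<le>
                  C * real V ^ 2 * (real T * real K) powr (2 / 3)
                    * ln (real T * real K * real V) powr a}
             \<ge> 1 - 1 / real T)))"
proof (rule exI[of _ "21 :: real"], rule exI[of _ "1 :: real"], intro conjI allI impI)
  fix K V :: nat
  assume K: "K \<ge> 2" and V: "V \<ge> 1"
  show "\<exists>T0. \<forall>T \<ge> T0. \<exists>\<eta> \<gamma> \<delta> :: real.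
      \<eta> > 0 \<and> 0 < \<gamma> \<and> \<gamma> \<le> 1 \<and> 0 < \<delta> \<and> \<delta> < 1 \<and>
      (\<forall>samp adv. valid_sampler K V \<gamma> samp \<longrightarrow> valid_adversary V adv \<longrightarrow>
         measure_pmf.prob (dark_pool K \<eta> \<gamma> \<delta> samp adv T)
           {(x, h). regret K V h \<le>
              21 * real V ^ 2 * (real T * real K) powr (2 / 3)
                * ln (real T * real K * real V) powr 1}
         \<ge> 1 - 1 / real T)"
  proof (intro exI[of _ "8 * K + V ^ 3"] allI impI)
    fix T :: nat
    assume T: "T \<ge> 8 * K + V ^ 3"
    define k where "k = real K powr (1 / 3)"
    define a where "a = real T powr (1 / 3)"
    have T16: "T \<ge> 16" using T K by linarith
    have k3: "k ^ 3 = real K" and a3: "a ^ 3 = real T"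
      unfolding k_def a_def using K T16 by (auto simp: powr_powr simp flip: powr_realpow)
    have k1: "1 \<le> k" unfolding k_def using K by (intro ge_one_powr_ge_zero) auto
    have a0: "0 < a" unfolding a_def using T16 by simp
    have "(2 * k) ^ 3 \<le> a ^ 3"
      using T unfolding power_mult_distrib k3 a3 by (simp flip: of_nat_le_iff)
    then have ka: "2 * k \<le> a" using a0 power_le_imp_le_base[of "2 * k" 2 a] by (simp add: numeral_3_eq_3)
    have "real V ^ 3 \<le> a ^ 3"
      using T unfolding a3 by (metis add_leD2 of_nat_le_iff of_nat_power)
    then have Va: "real V \<le> a" using a0 power_le_imp_le_base[of "real V" 2 a] by (simp add: numeral_3_eq_3)
    have a1: "1 \<le> a" using ka k1 by linarith
    \<comment> \<open>These values balance the three leading costs: \<open>1 / \<eta>\<close>,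
      \<open>T * \<gamma>\<close> and \<open>T * \<eta> * K / \<gamma>\<close> all equal
      \<open>k * a^2\<close>, that is \<open>K^(1/3) * T^(2/3)\<close>.\<close>
    define \<gamma> where "\<gamma> = k / a"
    define \<eta> where "\<eta> = 1 / (k * a\<^sup>2)"
    text \<open>This choice makes the correction term in \<open>g_hat\<close> at most \<open>10 / T\<close>.\<close>
    define \<delta> where "\<delta> = exp (- (1 / (real T)\<^sup>2))"
    define l where "l = ln (real T * real K * real V)"
    \<comment> \<open>Chosen so that the \<open>V * K + 1\<close> failure probabilities
      \<open>exp (- L)\<close> add up to exactly \<open>1 / T\<close>.\<close>
    define L where "L = ln (real T * (real V * real K + 1))"
    have gamma: "0 < \<gamma>" "\<gamma> \<le> 1" unfolding \<gamma>_def using k1 a0 ka by auto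
    have eta: "0 < \<eta>" unfolding \<eta>_def using k1 a0 by simp
    have delta: "0 < \<delta>" "\<delta> < 1" unfolding \<delta>_def using T16 by auto
    have sqrt_delta: "sqrt (ln (1 / \<delta>)) = 1 / real T"
      unfolding \<delta>_def by (simp add: ln_div real_sqrt_divide)
    have eta_K: "\<eta> * real K / \<gamma> = k / a"
      unfolding \<eta>_def \<gamma>_def k3[symmetric] using k1 a0
      by (simp add: field_simps power2_eq_square power3_eq_cube)
    have eta2: "2 * \<eta> * real K / \<gamma> \<le> 1"
    proof -
      have "2 * (\<eta> * real K / \<gamma>) \<le> 1" unfolding eta_K using ka a0 by simp
      then show ?thesis by simp
    qed
    have eta_V: "\<eta> * real V \<le> 1"
    proof -
      have "real V \<le> a\<^sup>2" using Va a1 mult_mono[of 1 a "real V" a] by (simp add: power2_eq_square)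
      also have "1 * a\<^sup>2 \<le> k * a\<^sup>2" using k1 by (intro mult_right_mono) auto
      finally show ?thesis unfolding \<eta>_def using k1 a0 by simp
    qed
    have TKV: "real T * 1 \<le> real T * real K * real V" "2 * real V \<le> real T * real K * real V"
      "real K \<le> real T * real K * real V" "2 \<le> real K * real V"
    proof -
      show KV: "2 \<le> real K * real V" using mult_mono[of 2 "real K" 1 "real V"] K V by simp
      show "real T * 1 \<le> real T * real K * real V"
        using mult_left_mono[of 1 "real K * real V" "real T"] KV by (simp add: mult.assoc)
      have "1 * real V \<le> real K * real V" using K by (intro mult_right_mono) auto
      moreover have "2 * (real K * real V) \<le> real T * (real K * real V)"
        using T16 by (intro mult_right_mono) auto
      ultimately show "2 * real V \<le> real T * real K * real V" by (simp add: mult.assoc)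
      have "real K * 1 \<le> real K * real V" using V by (intro mult_left_mono) auto
      then show "real K \<le> real T * real K * real V"
        using \<open>2 * (real K * real V) \<le> real T * (real K * real V)\<close> KV by (simp add: mult.assoc)
    qed
    have l1: "1 \<le> l"
    proof -
      have "exp 1 \<le> real T * real K * real V" using exp_le TKV(1) T16 by linarith
      then have "ln (exp 1) \<le> l" unfolding l_def using less_le_trans[OF exp_gt_zero] by (subst ln_le_cancel_iff) auto
      then show ?thesis by simp
    qed
    have lK: "ln (real K) \<le> l"
      unfolding l_def using TKV(3) K by (intro ln_mono) auto
    have lL: "L \<le> 2 * l"
    proof -
      let ?m = "real T * real K * real V"
      have "real T * (real V * real K + 1) \<le> real T * (2 * (real K * real V))"
        using TKV(4) by (intro mult_left_mono) auto
      also have "\<dots> = 2 * ?m" by simp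
      also have "\<dots> \<le> ?m * ?m"
      proof -
        have "2 \<le> ?m" using TKV(1) T16 by linarith
        then show ?thesis by (intro mult_right_mono) linarith+
      qed
      finally have "L \<le> ln (?m * ?m)"
        unfolding L_def using T16 by (intro ln_mono) (auto intro!: mult_pos_pos add_nonneg_pos)
      then show ?thesis unfolding l_def using T16 K V by (simp add: ln_mult)
    qed
    have powr_eq: "(real T * real K) powr (2 / 3) = a\<^sup>2 * k\<^sup>2"
      unfolding a_def k_def using T16 K by (simp add: powr_mult powr_powr flip: powr_realpow)
    have main: "measure_pmf.prob (dark_pool K \<eta> \<gamma> \<delta> samp adv T)
           {(x, h). regret K V h \<le> 21 * real V ^ 2 * (real T * real K) powr (2 / 3)
                * ln (real T * real K * real V) powr 1} \<ge> 1 - 1 / real T"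
      if samp: "valid_sampler K V \<gamma> samp" and adv: "valid_adversary V adv" for samp adv
    proof -
      interpret dark_pool_game K V \<eta> \<gamma> \<delta> samp adv
        using K gamma delta eta eta2 eta_V samp adv by unfold_locales auto
      have inv_eta: "1 / \<eta> = k * a\<^sup>2" unfolding \<eta>_def by simp
      \<comment> \<open>The 10 is the total effect of the correction terms over \<open>T\<close>
        rounds; the rest is the variance cost.\<close>
      have unit: "real T * unit_rate / \<eta> = 10 + 4 * (k * a\<^sup>2)"
      proof -
        have "real T * unit_rate / \<eta> = 10 + 4 * real T * (\<eta> * real K / \<gamma>)"
          unfolding unit_rate_def sqrt_delta using eta T16 by (simp add: field_simps power2_eq_square)
        also have "\<dots> = 10 + 4 * (k * a\<^sup>2)"
          unfolding eta_K a3[symmetric] using a0 by (simp add: power3_eq_cube power2_eq_square)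
        finally show ?thesis .
      qed
      have rounding: "real T * rounding_rate / \<eta> = k * a\<^sup>2 * real V + a * (real V)\<^sup>2 / k"
      proof -
        have "real T * rounding_rate / \<eta> = real T * \<gamma> * real V + real T * \<eta> * (real V)\<^sup>2"
          unfolding rounding_rate_def using eta by (simp add: field_simps power2_eq_square)
        then show ?thesis unfolding a3[symmetric] \<gamma>_def \<eta>_def
          using a0 k1 by (simp add: power3_eq_cube power2_eq_square)
      qed
      have "real V * ((ln (real K) + real T * unit_rate + L) / \<eta>) + (real T * rounding_rate + L) / \<eta>
          = real V * ((ln (real K) + L) * (1 / \<eta>) + real T * unit_rate / \<eta>)
            + real T * rounding_rate / \<eta> + L * (1 / \<eta>)"
        by (simp add: add_divide_distrib algebra_simps)
      also have "\<dots> = real V * ((ln (real K) + L) * (k * a\<^sup>2) + 10 + 4 * (k * a\<^sup>2))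
          + k * a\<^sup>2 * real V + a * (real V)\<^sup>2 / k + L * (k * a\<^sup>2)"
        unfolding unit rounding inv_eta by (simp add: add.assoc)
      also have "\<dots> \<le> 21 * ((real V)\<^sup>2 * (a\<^sup>2 * k\<^sup>2) * l)"
        using V by (intro regret_bound_arith k1 a1 l1 lK lL) simp
      also have "\<dots> = 21 * real V ^ 2 * (real T * real K) powr (2 / 3) * ln (real T * real K * real V) powr 1"
        unfolding powr_eq using l1 unfolding l_def by simp
      finally have bound: "real V * ((ln (real K) + real T * unit_rate + L) / \<eta>) + (real T * rounding_rate + L) / \<eta>
        \<le> 21 * real V ^ 2 * (real T * real K) powr (2 / 3) * ln (real T * real K * real V) powr 1" .
      have "(real V * real K + 1) * exp (- L) = 1 / real T"
      proof -
        have pos: "0 < real V * real K + 1" by (intro add_nonneg_pos) auto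
        then have "exp L = real T * (real V * real K + 1)"
          unfolding L_def using T16 by (intro exp_ln mult_pos_pos) auto
        then show ?thesis unfolding exp_minus using pos by (simp add: inverse_eq_divide)
      qed
      then have "1 - 1 / real T \<le> measure_pmf.prob (dark_pool K \<eta> \<gamma> \<delta> samp adv T)
         {(x, h). regret K V h \<le> real V * ((ln (real K) + real T * unit_rate + L) / \<eta>)
           + (real T * rounding_rate + L) / \<eta>}"
        using regret_high_probability[where t = T and L = L] by simp
      also have "\<dots> \<le> measure_pmf.prob (dark_pool K \<eta> \<gamma> \<delta> samp adv T)
         {(x, h). regret K V h \<le> 21 * real V ^ 2 * (real T * real K) powr (2 / 3)
            * ln (real T * real K * real V) powr 1}"
        using bound by (intro measure_pmf.finite_measure_mono) auto
      finally show ?thesis .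
    qed
    show "\<exists>\<eta> \<gamma> \<delta> :: real.
      \<eta> > 0 \<and> 0 < \<gamma> \<and> \<gamma> \<le> 1 \<and> 0 < \<delta> \<and> \<delta> < 1 \<and>
      (\<forall>samp adv. valid_sampler K V \<gamma> samp \<longrightarrow> valid_adversary V adv \<longrightarrow>
         measure_pmf.prob (dark_pool K \<eta> \<gamma> \<delta> samp adv T)
           {(x, h). regret K V h \<le>
              21 * real V ^ 2 * (real T * real K) powr (2 / 3)
                * ln (real T * real K * real V) powr 1}
         \<ge> 1 - 1 / real T)"
      using eta gamma delta main by blast
  qed
qed simp_all

end
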